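(* Let $(G,\sigma)$ and $(H,\sigma')$ be finite simple graphs with linear vertex orderings, let $\tau$ be any quasi-lexicographic ordering of $V(G\Box H)$, and let $\mathcal{C}$ be any proper vertex coloring of $G\Box H$. Then a subset $S\subseteq V(G\Box H)$ is a greedy defining set for $(G\Box H,\mathrm{lex},\mathcal{C})$ if and only if it is a greedy defining set for $(G\Box H,\tau,\mathcal{C})$.
   Context: $G\Box H$ is the Cartesian product: vertex set $V(G)\times V(H)$, with $(u,v)\sim(u',v')$ iff either $u=u'$ and $vv'\in E(H)$, or $uu'\in E(G)$ and $v=v'$. Lexicographic ordering $\mathrm{lex}$: $(u,v)$ precedes $(u',v')$ iff $\sigma(u)<\sigma(u')$, or $u=u'$ and $\sigma'(v)<\sigma'(v')$. An ordering $\tau$ is quasi-lexicographic if $\tau(u,v)<\tau(u',v')$ implies $\sigma(u)<\sigma(u')$ or $\sigma'(v)<\sigma'(v')$. First-Fit coloring subject to a pre-coloring of $S$: vertices of $S$ keep fixed colors; vertices not in $S$ are scanned in the given order and each receives the smallest positive integer not used on its already colored neighbors (vertices of $S$ count as colored from the start). $S$ is a greedy defining set of $(G\Box H,\rho,\mathcal{C})$ (for an ordering $\rho$) if the First-Fit coloring of $(G\Box H,\rho)$ subject to the restriction of $\mathcal{C}$ to $S$ equals $\mathcal{C}$. *)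

theory Defs
  imports "Graph_Theory.Graph_Theory"
begin

text \<open>
  Finite simple graphs are represented by \<^locale>\<open>pair_graph\<close>: finite, loopfree, with a
  symmetric set of arcs. A linear ordering of a vertex set \<open>V\<close> is a strict order relation
  \<open>\<sigma>\<close> with \<^term>\<open>strict_linear_order_on V \<sigma>\<close>; membership of \<open>(u, u')\<close> in \<open>\<sigma>\<close> is
  \<open>\<sigma>(u) < \<sigma>(u')\<close>. The lexicographic ordering of \<open>V(G) \<times> V(H)\<close> is then the library's
  \<open>\<sigma> <*lex*> \<sigma>'\<close>.
\<close>

definition cart_prod ::
  "'a pair_pre_digraph \<Rightarrow> 'b pair_pre_digraph \<Rightarrow> ('a \<times> 'b) pair_pre_digraph" (infixl "\<box>" 70)
  where
  "G \<box> H =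
    \<lparr> pverts = pverts G \<times> pverts H,
      parcs = {((u, v), (u', v')).
        (u = u' \<and> u \<in> pverts G \<and> (v, v') \<in> parcs H) \<or>
        ((u, u') \<in> parcs G \<and> v = v' \<and> v \<in> pverts H)} \<rparr>"

definition quasi_lexicographic ::
  "'a pair_pre_digraph \<Rightarrow> 'a rel \<Rightarrow> 'b pair_pre_digraph \<Rightarrow> 'b rel \<Rightarrow> ('a \<times> 'b) rel \<Rightarrow> bool"
  where
  "quasi_lexicographic G \<sigma> H \<sigma>' \<tau> \<longleftrightarrow>
    (\<forall>u \<in> pverts G. \<forall>v \<in> pverts H. \<forall>u' \<in> pverts G. \<forall>v' \<in> pverts H.
      ((u, v), (u', v')) \<in> \<tau> \<longrightarrow> (u, u') \<in> \<sigma> \<or> (v, v') \<in> \<sigma>')"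

text \<open>Colors are positive integers.\<close>

definition proper_coloring :: "'a pair_pre_digraph \<Rightarrow> ('a \<Rightarrow> nat) \<Rightarrow> bool" where
  "proper_coloring G C \<longleftrightarrow>
    (\<forall>v \<in> pverts G. 0 < C v) \<and> (\<forall>(u, v) \<in> parcs G. C u \<noteq> C v)"

definition increasing_list :: "'a rel \<Rightarrow> 'a set \<Rightarrow> 'a list" where
  "increasing_list \<rho> V = (THE xs. sorted_wrt (\<lambda>x y. (x, y) \<in> \<rho>) xs \<and> set xs = V)"

text \<open>Partial colorings are maps, with \<^const>\<open>None\<close> on the vertices not yet colored.\<close>

definition first_fit_step ::
  "'a pair_pre_digraph \<Rightarrow> 'a \<Rightarrow> ('a \<rightharpoonup> nat) \<Rightarrow> ('a \<rightharpoonup> nat)" where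
  "first_fit_step G v c = c(v \<mapsto> (LEAST k. 0 < k \<and> (\<forall>w. (v, w) \<in> parcs G \<longrightarrow> c w \<noteq> Some k)))"

definition first_fit ::
  "'a pair_pre_digraph \<Rightarrow> 'a rel \<Rightarrow> ('a \<rightharpoonup> nat) \<Rightarrow> ('a \<rightharpoonup> nat)" where
  "first_fit G \<rho> p = fold (first_fit_step G) (increasing_list \<rho> (pverts G - dom p)) p"

definition greedy_defining_set ::
  "'a pair_pre_digraph \<Rightarrow> 'a rel \<Rightarrow> ('a \<Rightarrow> nat) \<Rightarrow> 'a set \<Rightarrow> bool" where
  "greedy_defining_set G \<rho> C S \<longleftrightarrow>
    first_fit G \<rho> ((Some \<circ> C) |` S) = (Some \<circ> C) |` pverts G"

lemma pair_graph_cart_prod: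
  assumes "pair_graph G" "pair_graph H"
  shows "pair_graph (G \<box> H)"
proof -
  interpret G: pair_graph G by fact
  interpret H: pair_graph H by fact
  have sub: "parcs (G \<box> H) \<subseteq> (pverts G \<times> pverts H) \<times> (pverts G \<times> pverts H)"
    by (auto simp: cart_prod_def dest: G.wellformed' H.wellformed')
  have "sym (parcs G)" "sym (parcs H)"
    using G.pair_sym_arcs H.pair_sym_arcs by (auto simp: symmetric_def)
  then have "sym (parcs (G \<box> H))"
    by (auto simp: cart_prod_def sym_def)
  moreover have "finite (parcs (G \<box> H))"
    using sub G.pair_finite_verts H.pair_finite_verts by (meson finite_SigmaI finite_subset)
  ultimately show ?thesis
    using sub G.pair_finite_verts H.pair_finite_verts
    by unfold_locales
      (auto simp: symmetric_def cart_prod_def dest: G.wellformed' H.wellformed'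
        G.pair_no_loops H.pair_no_loops)
qed

lemma strict_linear_order_on_lex_prod:
  assumes "strict_linear_order_on V \<sigma>" "strict_linear_order_on W \<sigma>'"
  shows "strict_linear_order_on (V \<times> W) (\<sigma> <*lex*> \<sigma>')"
  using assms unfolding strict_linear_order_on_def
  by (auto simp: irrefl_def total_on_def intro: trans_lex_prod)

lemma quasi_lexicographic_lex_prod: "quasi_lexicographic G \<sigma> H \<sigma>' (\<sigma> <*lex*> \<sigma>')"
  by (auto simp: quasi_lexicographic_def)

lemma ex1_increasing_list:
  assumes "finite V" "strict_linear_order_on V \<rho>"
  shows "\<exists>!xs. sorted_wrt (\<lambda>x y. (x, y) \<in> \<rho>) xs \<and> set xs = V"
proof (rule ex_ex1I)
  let ?P = "\<lambda>x y. (x, y) \<in> \<rho>"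
  have tr: "trans \<rho>" and ir: "irrefl \<rho>" and tot: "total_on V \<rho>"
    using assms(2) by (auto simp: strict_linear_order_on_def)
  show "\<exists>xs. sorted_wrt ?P xs \<and> set xs = V"
    using assms(1) tot
  proof (induction V rule: finite_induct)
    case (insert a V)
    then obtain xs where xs: "sorted_wrt ?P xs" "set xs = V"
      by (auto simp: total_on_def)
    let ?ys = "filter (\<lambda>x. ?P x a) xs @ a # filter (\<lambda>x. ?P a x) xs"
    have "sorted_wrt ?P ?ys"
      using xs(1) transD[OF tr] by (auto simp: sorted_wrt_append sorted_wrt_filter)
    moreover have "set ?ys = insert a V"
      using xs(2) insert.prems insert.hyps by (auto simp: total_on_def)
    ultimately show ?case by blast
  qed simp
  have "xs = ys"
    if "sorted_wrt ?P xs" "sorted_wrt ?P ys" "set xs = set ys" for xs ys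
    using that
  proof (induction xs arbitrary: ys)
    case (Cons x xs)
    then obtain y ys' where ys: "ys = y # ys'" by (cases ys) auto
    have nrefl: "\<not> ?P u u" for u
      using ir by (simp add: irrefl_def)
    have "x = y"
    proof (rule ccontr)
      assume "x \<noteq> y"
      then have "x \<in> set ys'" "y \<in> set xs"
        using Cons.prems(3) unfolding ys by auto
      then have "?P y x" "?P x y"
        using Cons.prems(1,2) unfolding ys by auto
      then show False using nrefl transD[OF tr] by blast
    qed
    moreover have "x \<notin> set xs" "y \<notin> set ys'"
      using Cons.prems nrefl unfolding ys by auto
    ultimately have "set xs = set ys'"
      using Cons.prems(3) unfolding ys by (simp add: insert_ident)
    then have "xs = ys'"
      using Cons.IH Cons.prems(1,2) unfolding ys by simp
    with \<open>x = y\<close> show ?case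
      unfolding ys by simp
  qed simp
  then show "xs = ys" if "sorted_wrt ?P xs \<and> set xs = V" "sorted_wrt ?P ys \<and> set ys = V" for xs ys
    using that by blast
qed

end

theory Submission
  imports Defs
begin

text \<open>
  First-Fit reproduces a coloring iff every vertex outside the pre-colored set carries the least
  positive color missing among its pre-colored and its earlier neighbors. This condition only
  looks at the ordering on pairs of adjacent vertices. Adjacent vertices of a Cartesian product
  share a coordinate, so on them every quasi-lexicographic ordering agrees with the
  lexicographic one.
\<close>

text \<open>The colored vertices are given as a set \<open>A\<close> under a fixed total
  \<open>C\<close>, not as a partial map, so that an ordering can enter only through
  \<open>A\<close>.\<close>

definition least_free_color ::
  "'a pair_pre_digraph \<Rightarrow> ('a \<Rightarrow> nat) \<Rightarrow> 'a set \<Rightarrow> 'a \<Rightarrow> nat" where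
  "least_free_color G C A v = (LEAST k. 0 < k \<and> (\<forall>w \<in> A. (v, w) \<in> parcs G \<longrightarrow> C w \<noteq> k))"

lemma least_free_color_cong:
  assumes "\<And>w. (v, w) \<in> parcs G \<Longrightarrow> w \<in> A \<longleftrightarrow> w \<in> B"
  shows "least_free_color G C A v = least_free_color G C B v"
  using assms unfolding least_free_color_def by (metis (no_types, lifting))

text \<open>As long as a run has reproduced \<open>C\<close>, its state is a restriction of
  \<open>C\<close>; this computes the next step from such a state.\<close>

lemma first_fit_step_restrict:
  "first_fit_step G v ((Some \<circ> C) |` A) = ((Some \<circ> C) |` A)(v \<mapsto> least_free_color G C A v)"
proof -
  have "(\<forall>w. (v, w) \<in> parcs G \<longrightarrow> ((Some \<circ> C) |` A) w \<noteq> Some k) \<longleftrightarrow>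
      (\<forall>w \<in> A. (v, w) \<in> parcs G \<longrightarrow> C w \<noteq> k)" for k
    by (auto simp: restrict_map_def)
  then show ?thesis
    by (simp add: first_fit_step_def least_free_color_def)
qed

lemma fold_first_fit_step_other:
  "v \<notin> set xs \<Longrightarrow> fold (first_fit_step G) xs c v = c v"
  by (induction xs arbitrary: c) (auto simp: first_fit_step_def)

text \<open>Induction on the list, with \<open>A\<close> the set colored so far. If the head
  receives its color under \<open>C\<close>, the new state is again a restriction, now to
  \<open>insert x A\<close>. If not, the wrong color is never revised, since a strictly sorted list
  does not repeat a vertex.\<close>

lemma fold_first_fit_step_eq_iff:
  assumes "trans \<rho>" "irrefl \<rho>"
    and "sorted_wrt (\<lambda>x y. (x, y) \<in> \<rho>) xs" "A \<inter> set xs = {}"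
  shows "fold (first_fit_step G) xs ((Some \<circ> C) |` A) = (Some \<circ> C) |` (A \<union> set xs) \<longleftrightarrow>
    (\<forall>v \<in> set xs. C v = least_free_color G C (A \<union> {w \<in> set xs. (w, v) \<in> \<rho>}) v)"
  using assms(3,4)
proof (induction xs arbitrary: A)
  case Nil
  then show ?case by simp
next
  case (Cons x xs)
  have nrefl: "(u, u) \<notin> \<rho>" for u
    using assms(2) by (simp add: irrefl_def)
  have less: "(x, y) \<in> \<rho>" "(y, x) \<notin> \<rho>" if "y \<in> set xs" for y
  proof -
    show "(x, y) \<in> \<rho>"
      using Cons.prems(1) that by simp
    then show "(y, x) \<notin> \<rho>"
      using nrefl transD[OF assms(1)] by blast
  qed
  have x: "x \<notin> set xs" "x \<notin> A"
    using less nrefl Cons.prems(2) by auto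
  \<comment> \<open>The head of a sorted list has no predecessor in it, so its condition refers to
    \<open>A\<close> alone.\<close>
  have before_x: "A \<union> {w \<in> set (x # xs). (w, x) \<in> \<rho>} = A"
    using less nrefl by auto
  \<comment> \<open>Since \<open>x\<close> precedes every later \<open>y\<close>, moving
    \<open>x\<close> from the list into \<open>A\<close> leaves the condition at \<open>y\<close>
    unchanged.\<close>
  have before_y: "A \<union> {w \<in> set (x # xs). (w, y) \<in> \<rho>} = insert x A \<union> {w \<in> set xs. (w, y) \<in> \<rho>}"
    if "y \<in> set xs" for y
    using less that by auto
  show ?case
  proof (cases "C x = least_free_color G C A x")
    case True
    then have "first_fit_step G x ((Some \<circ> C) |` A) = (Some \<circ> C) |` insert x A"
      unfolding first_fit_step_restrict by (auto simp: restrict_map_def)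
    moreover have "insert x A \<inter> set xs = {}"
      using x Cons.prems(2) by auto
    moreover have "A \<union> set (x # xs) = insert x A \<union> set xs"
      by simp
    ultimately show ?thesis
      using Cons.IH[of "insert x A"] Cons.prems(1) True before_x before_y by (simp add: comp_def)
  next
    case False
    \<comment> \<open>The remaining steps do not touch \<open>x\<close>, so the final map and the
      restriction of \<open>C\<close> differ there.\<close>
    have "fold (first_fit_step G) (x # xs) ((Some \<circ> C) |` A) x = Some (least_free_color G C A x)"
      using x by (simp add: fold_first_fit_step_other first_fit_step_restrict)
    moreover have "((Some \<circ> C) |` (A \<union> set (x # xs))) x = Some (C x)"
      by simp
    ultimately have "fold (first_fit_step G) (x # xs) ((Some \<circ> C) |` A) \<noteq>
        (Some \<circ> C) |` (A \<union> set (x # xs))"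
      using False by (metis option.inject)
    then show ?thesis
      using False before_x by (metis list.set_intros(1))
  qed
qed

text \<open>Applies the criterion for \<open>fold\<close> to the increasing list of the vertices
  outside \<open>S\<close>. The predecessor set is then freed of its restriction to
  \<open>pverts G - S\<close>, which leaves \<open>\<rho>\<close> as the only trace of the
  ordering.\<close>

lemma greedy_defining_set_iff:
  assumes "pair_graph G" "strict_linear_order_on (pverts G) \<rho>" "S \<subseteq> pverts G"
  shows "greedy_defining_set G \<rho> C S \<longleftrightarrow>
    (\<forall>v \<in> pverts G - S. C v = least_free_color G C (S \<union> {w. (w, v) \<in> \<rho>}) v)"
proof -
  interpret pair_graph G by fact
  define xs where "xs = increasing_list \<rho> (pverts G - S)"
  have "strict_linear_order_on (pverts G - S) \<rho>"
    using assms(2) by (auto simp: strict_linear_order_on_def total_on_def)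
  then have xs: "sorted_wrt (\<lambda>x y. (x, y) \<in> \<rho>) xs" "set xs = pverts G - S"
    using theI'[OF ex1_increasing_list[of "pverts G - S" \<rho>]]
    by (simp_all add: xs_def increasing_list_def)
  have "dom ((Some \<circ> C) |` S) = S"
    by (auto simp: restrict_map_def dom_def)
  then have "greedy_defining_set G \<rho> C S \<longleftrightarrow>
      fold (first_fit_step G) xs ((Some \<circ> C) |` S) = (Some \<circ> C) |` (S \<union> set xs)"
    using xs(2) assms(3) by (simp add: greedy_defining_set_def first_fit_def xs_def Un_absorb1)
  also have "\<dots> \<longleftrightarrow> (\<forall>v \<in> pverts G - S.
      C v = least_free_color G C (S \<union> {w \<in> pverts G - S. (w, v) \<in> \<rho>}) v)"
    using fold_first_fit_step_eq_iff[of \<rho> xs S G C] xs assms(2)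
    by (auto simp: strict_linear_order_on_def)
  also have "\<dots> \<longleftrightarrow>
      (\<forall>v \<in> pverts G - S. C v = least_free_color G C (S \<union> {w. (w, v) \<in> \<rho>}) v)"
  proof (rule ball_cong[OF refl])
    fix v
    \<comment> \<open>Neighbors of \<open>v\<close> are vertices of \<open>G\<close>, and those in
      \<open>S\<close> belong to both sets anyway.\<close>
    have "least_free_color G C (S \<union> {w \<in> pverts G - S. (w, v) \<in> \<rho>}) v =
        least_free_color G C (S \<union> {w. (w, v) \<in> \<rho>}) v"
      by (rule least_free_color_cong) (auto dest: wellformed')
    then show "C v = least_free_color G C (S \<union> {w \<in> pverts G - S. (w, v) \<in> \<rho>}) v \<longleftrightarrow>
        C v = least_free_color G C (S \<union> {w. (w, v) \<in> \<rho>}) v"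
      by simp
  qed
  finally show ?thesis .
qed

lemma greedy_defining_set_cong_order:
  assumes "pair_graph G" "S \<subseteq> pverts G"
    and "strict_linear_order_on (pverts G) \<rho>" "strict_linear_order_on (pverts G) \<rho>'"
    and "\<And>v w. (v, w) \<in> parcs G \<Longrightarrow> (w, v) \<in> \<rho> \<longleftrightarrow> (w, v) \<in> \<rho>'"
  shows "greedy_defining_set G \<rho> C S \<longleftrightarrow> greedy_defining_set G \<rho>' C S"
proof -
  have "least_free_color G C (S \<union> {w. (w, v) \<in> \<rho>}) v =
      least_free_color G C (S \<union> {w. (w, v) \<in> \<rho>'}) v" for v
    by (rule least_free_color_cong) (auto simp: assms(5))
  then show ?thesis
    using assms by (simp add: greedy_defining_set_iff)
qed

text \<open>Irreflexivity excludes the alternative in the shared coordinate. The strict inequality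
  in the other coordinate is then exactly the lexicographic comparison.\<close>

lemma quasi_lexicographic_adjacent_imp_lex:
  assumes "irrefl \<sigma>" "irrefl \<sigma>'" "quasi_lexicographic G \<sigma> H \<sigma>' \<tau>"
    and "x \<in> pverts (G \<box> H)" "y \<in> pverts (G \<box> H)" "(x, y) \<in> parcs (G \<box> H) \<or> (y, x) \<in> parcs (G \<box> H)"
    and "(x, y) \<in> \<tau>"
  shows "(x, y) \<in> \<sigma> <*lex*> \<sigma>'"
proof -
  obtain u v u' v' where xy: "x = (u, v)" "y = (u', v')"
    by fastforce
  then have "u = u' \<or> v = v'"
    using assms(6) by (auto simp: cart_prod_def)
  moreover have "(u, u') \<in> \<sigma> \<or> (v, v') \<in> \<sigma>'"
    using assms(3-5,7) unfolding xy by (simp add: cart_prod_def quasi_lexicographic_def)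
  ultimately show ?thesis
    using assms(1,2) unfolding xy by (auto simp: irrefl_def)
qed

theorem theorem7:
  fixes G :: "'a pair_pre_digraph" and H :: "'b pair_pre_digraph"
    and \<sigma> :: "'a rel" and \<sigma>' :: "'b rel" and \<tau> :: "('a \<times> 'b) rel"
    and C :: "'a \<times> 'b \<Rightarrow> nat" and S :: "('a \<times> 'b) set"
  assumes "pair_graph G" and "pair_graph H"
    and "strict_linear_order_on (pverts G) \<sigma>"
    and "strict_linear_order_on (pverts H) \<sigma>'"
    and "strict_linear_order_on (pverts (G \<box> H)) \<tau>"
    and "quasi_lexicographic G \<sigma> H \<sigma>' \<tau>"
    and "proper_coloring (G \<box> H) C"
    and "S \<subseteq> pverts (G \<box> H)"
  shows "greedy_defining_set (G \<box> H) (\<sigma> <*lex*> \<sigma>') C S \<longleftrightarrow> greedy_defining_set (G \<box> H) \<tau> C S"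
proof -
  interpret P: pair_graph "G \<box> H"
    using assms(1,2) by (rule pair_graph_cart_prod)
  have lex: "strict_linear_order_on (pverts (G \<box> H)) (\<sigma> <*lex*> \<sigma>')"
    using strict_linear_order_on_lex_prod[OF assms(3,4)] by (simp add: cart_prod_def)
  have irr: "irrefl \<sigma>" "irrefl \<sigma>'"
    using assms(3,4) by (auto simp: strict_linear_order_on_def)
  show ?thesis
  proof (rule greedy_defining_set_cong_order[OF P.pair_graph_axioms assms(8) lex assms(5)])
    fix x y
    assume arc: "(x, y) \<in> parcs (G \<box> H)"
    then have xy: "x \<in> pverts (G \<box> H)" "y \<in> pverts (G \<box> H)" "x \<noteq> y"
      by (auto dest: P.wellformed' P.pair_no_loops)
    note to_lex = quasi_lexicographic_adjacent_imp_lex[OF irr assms(6)]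
    \<comment> \<open>\<open>to_lex\<close> gives only one implication. For the converse,
      \<open>\<tau>\<close> orders the two ends in some direction, \<open>to_lex\<close> carries
      that direction over, and asymmetry of the lexicographic order rules out the opposite
      one.\<close>
    have "(y, x) \<in> \<tau> \<or> (x, y) \<in> \<tau>"
      using assms(5) xy by (auto simp: strict_linear_order_on_def total_on_def)
    moreover have "\<not> ((x, y) \<in> \<sigma> <*lex*> \<sigma>' \<and> (y, x) \<in> \<sigma> <*lex*> \<sigma>')"
      using lex unfolding strict_linear_order_on_def irrefl_def by (meson transD)
    ultimately show "(y, x) \<in> \<sigma> <*lex*> \<sigma>' \<longleftrightarrow> (y, x) \<in> \<tau>"
      using to_lex[of x y] to_lex[of y x] xy arc by blast
  qed
qed

end
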